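(* Let $\theta_0:\mathbb{R}\to\mathbb{R}$ be smooth, non-negative, decaying at infinity, even, monotone decreasing on $(0,\infty)$, and such that $\theta_0(1/2)<\theta_0(0)$. Then the equation $$\partial_t\theta+u\,\partial_x\theta=0,\qquad u=H\theta,$$ with $\theta(0,\cdot)=\theta_0$ cannot have a global in time $C^1$ solution.
   Context: $H$ is the Hilbert transform in $x$, $H\theta(x)=\frac1\pi\,\mathrm{p.v.}\int_{\mathbb{R}}\frac{\theta(y)}{y-x}\,dy$; for even $\theta$, $H\theta(x)=\frac{2x}{\pi}\int_0^\infty\frac{\theta(y)-\theta(x)}{y^2-x^2}\,dy$. A global in time $C^1$ solution is a real-valued $C^1$ function on $[0,\infty)\times\mathbb{R}$ satisfying the equation pointwise. The paper's convention in this setting is that solutions inherit from the data the properties of being non-negative, decaying at infinity, even, and monotone decreasing on $(0,\infty)$ for positive times. *)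

theory Defs
  imports "HOL-Analysis.Analysis"
begin

definition smooth :: "(real \<Rightarrow> real) \<Rightarrow> bool" where
  "smooth f \<longleftrightarrow> (\<forall>n x. ((deriv ^^ n) f) field_differentiable (at x))"

definition even_function :: "(real \<Rightarrow> real) \<Rightarrow> bool" where
  "even_function f \<longleftrightarrow> (\<forall>x. f (- x) = f x)"

definition decays_at_infinity :: "(real \<Rightarrow> real) \<Rightarrow> bool" where
  "decays_at_infinity f \<longleftrightarrow> (f \<longlongrightarrow> 0) at_infinity"

text \<open>The principal value is taken at the singularity and at infinity (inner and outer
  radius vary independently): decay of \<open>f\<close> alone does not make \<open>f y / (y - x)\<close> integrable
  near infinity. For even, bounded, continuously differentiable \<open>f\<close> and \<open>x \<noteq> 0\<close>, this limit is the
  absolutely convergent integral of \<open>(2 * x / pi) * (f y - f x) / (y\<^sup>2 - x\<^sup>2)\<close> over \<open>y > 0\<close>. A relation is used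
  so that existence of the limit is part of the assertion. Note the sign convention
  \<open>y - x\<close> in the kernel.\<close>

definition has_hilbert_transform :: "(real \<Rightarrow> real) \<Rightarrow> real \<Rightarrow> real \<Rightarrow> bool" where
  "has_hilbert_transform f x h \<longleftrightarrow>
     ((\<lambda>(\<epsilon>, R). 1 / pi * (LINT y:{y. \<epsilon> < \<bar>y - x\<bar> \<and> \<bar>y - x\<bar> < R}|lborel. f y / (y - x)))
        \<longlongrightarrow> h) (at_right 0 \<times>\<^sub>F at_top)"

text \<open>The first argument of \<open>\<theta>\<close> is time; its values at negative times are irrelevant,
  and the time derivative at \<open>t = 0\<close> is one-sided.\<close>

definition has_C1_partials ::
  "(real \<Rightarrow> real \<Rightarrow> real) \<Rightarrow> (real \<Rightarrow> real \<Rightarrow> real) \<Rightarrow> (real \<Rightarrow> real \<Rightarrow> real) \<Rightarrow> bool" where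
  "has_C1_partials \<theta> \<theta>\<^sub>t \<theta>\<^sub>x \<longleftrightarrow>
     (\<forall>t\<ge>0. \<forall>x. ((\<lambda>s. \<theta> s x) has_real_derivative \<theta>\<^sub>t t x) (at t within {0..}) \<and>
                ((\<lambda>y. \<theta> t y) has_real_derivative \<theta>\<^sub>x t x) (at x)) \<and>
     continuous_on ({0..} \<times> UNIV) (\<lambda>(t, x). \<theta>\<^sub>t t x) \<and>
     continuous_on ({0..} \<times> UNIV) (\<lambda>(t, x). \<theta>\<^sub>x t x)"

definition global_C1_solution :: "(real \<Rightarrow> real \<Rightarrow> real) \<Rightarrow> bool" where
  "global_C1_solution \<theta> \<longleftrightarrow>
     (\<exists>\<theta>\<^sub>t \<theta>\<^sub>x u. has_C1_partials \<theta> \<theta>\<^sub>t \<theta>\<^sub>x \<and>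
        (\<forall>t\<ge>0. \<forall>x. has_hilbert_transform (\<theta> t) x (u t x) \<and>
                   \<theta>\<^sub>t t x + u t x * \<theta>\<^sub>x t x = 0))"

end

theory Submission
  imports Defs
begin

text \<open>With \<open>g = \<theta> t 0 - \<theta> t x\<close>, the velocity satisfies \<open>- pi * u \<ge> g - h\<close>, where \<open>h x\<close> is the
  average of \<open>g\<close> over \<open>{0..x}\<close>: the flow compresses towards the origin. Hence the bounded quantity
  \<open>J t = \<integral> g (s\<^sup>2)\<close> over \<open>s \<in> {0..1}\<close> satisfies \<open>J' \<ge> c * J\<^sup>2\<close> with \<open>J 0 > 0\<close>, which is absurd. Up to a
  factor, \<open>J\<close> is the integral of \<open>g x / sqrt x\<close>; the substitution \<open>x = s\<^sup>2\<close> removes the singular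
  weight, so that the integral can be differentiated in time.\<close>

section \<open>Even profiles decreasing away from the origin\<close>

text \<open>Evenness reduces the comparison to \<open>\<bar>a\<bar>\<close> and
  \<open>\<bar>b\<bar>\<close>. Monotonicity on \<open>{0<..}\<close> is silent about the origin
  itself; \<open>f 0\<close> is compared as the limit of \<open>f\<close> from the right, which is
  where continuity enters.\<close>

lemma even_antimono_abs_le:
  fixes f :: "real \<Rightarrow> real"
  assumes ev: "even_function f" and anti: "antimono_on {0<..} f" and cont: "continuous_on UNIV f"
    and le: "\<bar>a\<bar> \<le> \<bar>b\<bar>"
  shows "f b \<le> f a"
proof -
  have abs_eq: "f \<bar>x\<bar> = f x" for x
    using ev by (auto simp: even_function_def abs_if)
  have "f \<bar>b\<bar> \<le> f \<bar>a\<bar>"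
  proof (cases "a = 0")
    case False
    then show ?thesis using anti le by (auto simp: monotone_on_def)
  next
    case True
    show ?thesis
    proof (cases "b = 0")
      case False
      have "(f \<longlongrightarrow> f 0) (at_right 0)"
        using cont by (auto simp: continuous_on_eq_continuous_at isCont_def intro: filterlim_at_split[THEN iffD1, THEN conjunct2])
      moreover have "\<forall>\<^sub>F x in at_right 0. f \<bar>b\<bar> \<le> f x"
        unfolding eventually_at_right_field
        using anti False by (intro exI[of _ "\<bar>b\<bar>"]) (auto simp: monotone_on_def)
      ultimately show ?thesis
        using True by (auto intro: tendsto_lowerbound)
    qed (use True in simp)
  qed
  then show ?thesis by (simp add: abs_eq)
qed

text \<open>A positive derivative would make \<open>f\<close> strictly larger just to the right of
  \<open>x\<close>. Only right neighbours are tested, so the argument covers \<open>x = 0\<close> as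
  well.\<close>

lemma even_antimono_deriv_nonpos:
  fixes f :: "real \<Rightarrow> real"
  assumes ev: "even_function f" and anti: "antimono_on {0<..} f" and cont: "continuous_on UNIV f"
    and der: "(f has_real_derivative D) (at x)" and x: "0 \<le> x"
  shows "D \<le> 0"
proof (rule ccontr)
  assume "\<not> D \<le> 0"
  then obtain d where d: "d > 0" "\<forall>h>0. h < d \<longrightarrow> f x < f (x + h)"
    using DERIV_pos_inc_right[OF der] by auto
  have "f x < f (x + d / 2)" using d by simp
  moreover have "f (x + d / 2) \<le> f x"
    using d x by (intro even_antimono_abs_le[OF ev anti cont]) auto
  ultimately show False by simp
qed

text \<open>This removes the transport term at the origin without any information on the velocity
  there.\<close>

lemma even_deriv_zero:
  fixes f :: "real \<Rightarrow> real"
  assumes ev: "even_function f" and der: "(f has_real_derivative D) (at 0)"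
  shows "D = 0"
proof -
  have "((\<lambda>x. f (- x)) has_real_derivative D * - 1) (at 0)"
    by (rule DERIV_chain2[where f = f]) (auto intro!: derivative_eq_intros der)
  moreover have "(\<lambda>x. f (- x)) = f" using ev by (auto simp: even_function_def)
  ultimately have "D * - 1 = D" using DERIV_unique der by metis
  then show ?thesis by simp
qed

section \<open>One-sided bound for the Hilbert transform\<close>

text \<open>Reflecting the part left of \<open>x\<close> onto the part right of it pairs
  \<open>x - z\<close> with \<open>x + z\<close>. For \<open>0 < x\<close> and even decreasing
  \<open>f\<close> the folded integrand has a sign, although the kernel does not. The minus sign
  comes from the orientation \<open>y - x\<close> of the kernel.\<close>

lemma punctured_kernel_integral:
  fixes f :: "real \<Rightarrow> real"
  assumes cont: "continuous_on UNIV f" and e: "0 < \<epsilon>" "\<epsilon> < R"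
  shows "(LINT y:{y. \<epsilon> < \<bar>y - x\<bar> \<and> \<bar>y - x\<bar> < R}|lborel. f y / (y - x)) =
    - integral {\<epsilon>..R} (\<lambda>z. (f (x - z) - f (x + z)) / z)"
proof -
  let ?k = "\<lambda>y. f y / (y - x)"
  have cf: "continuous_on A f" for A using cont continuous_on_subset by blast
  have set_eq: "{y. \<epsilon> < \<bar>y - x\<bar> \<and> \<bar>y - x\<bar> < R} = {x-R<..<x-\<epsilon>} \<union> {x+\<epsilon><..<x+R}"
    using e by auto
  have "set_integrable lborel {x-R..x-\<epsilon>} ?k" "set_integrable lborel {x+\<epsilon>..x+R} ?k"
    using e by (intro borel_integrable_atLeastAtMost' continuous_intros cf; auto)+
  then have i: "set_integrable lborel {x-R<..<x-\<epsilon>} ?k" "set_integrable lborel {x+\<epsilon><..<x+R} ?k"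
    by - (erule set_integrable_subset; force)+
  have "(LINT y:{y. \<epsilon> < \<bar>y - x\<bar> \<and> \<bar>y - x\<bar> < R}|lborel. ?k y)
      = integral {x-R<..<x-\<epsilon>} ?k + integral {x+\<epsilon><..<x+R} ?k"
    unfolding set_eq using e i
    by (subst set_integral_Un) (auto simp: set_borel_integral_eq_integral)
  also have "\<dots> = integral {x-R..x-\<epsilon>} ?k + integral {x+\<epsilon>..x+R} ?k"
    by (simp add: integral_open_interval_real)
  also have "integral {x+\<epsilon>..x+R} ?k = integral {\<epsilon>..R} (\<lambda>z. f (x + z) / z)"
    using integral_shift_real_ivl[of "x+\<epsilon>" x "x+R" ?k] by (simp add: add.commute)
  also have "integral {x-R..x-\<epsilon>} ?k = integral {-R..-\<epsilon>} (\<lambda>z. f (x + z) / z)"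
    using integral_shift_real_ivl[of "x-R" x "x-\<epsilon>" ?k] by (simp add: add.commute)
  also have "\<dots> = integral {\<epsilon>..R} (\<lambda>z. - (f (x - z) / z))"
    using Henstock_Kurzweil_Integration.integral_reflect_real[of R \<epsilon> "\<lambda>z. - (f (x - z) / z)"] by simp
  also have "\<dots> + integral {\<epsilon>..R} (\<lambda>z. f (x + z) / z)
      = integral {\<epsilon>..R} (\<lambda>z. - (f (x - z) / z) + f (x + z) / z)"
    using e by (intro Henstock_Kurzweil_Integration.integral_add[symmetric] integrable_continuous_real continuous_intros
        continuous_on_compose2[OF cont]) auto
  also have "\<dots> = integral {\<epsilon>..R} (\<lambda>z. - ((f (x - z) - f (x + z)) / z))"
    by (intro integral_cong) (auto simp: diff_divide_distrib)
  finally show ?thesis by simp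
qed

text \<open>While \<open>z\<close> runs over \<open>{0..2*x}\<close>, the point \<open>x - z\<close>
  sweeps the symmetric interval \<open>{-x..x}\<close>. This is how the average over
  \<open>{0..x}\<close> comes out of an integral folded about \<open>x\<close>.\<close>

lemma integral_even_about:
  fixes f :: "real \<Rightarrow> real"
  assumes ev: "even_function f" and cont: "continuous_on UNIV f" and x: "0 \<le> x"
  shows "integral {0..2*x} (\<lambda>z. f (x - z)) = 2 * integral {0..x} f"
proof -
  have cf: "continuous_on A f" for A using cont continuous_on_subset by blast
  have fm: "(\<lambda>x. f (- x)) = f" using ev by (auto simp: even_function_def)
  have "integral {0..2*x} (\<lambda>z. f (x - z)) = integral {0..2*x} (\<lambda>z. f (z - x))"
    by (metis fm minus_diff_eq)
  also have "\<dots> = integral {-x..x} f"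
    using integral_shift_real_ivl[of 0 x "2*x" "\<lambda>z. f (z - x)"] by simp
  also have "\<dots> = integral {-x..0} f + integral {0..x} f"
    using x by (intro Henstock_Kurzweil_Integration.integral_combine[symmetric] integrable_continuous_real cf) auto
  also have "integral {-x..0} f = integral {0..x} f"
    using Henstock_Kurzweil_Integration.integral_reflect_real[of x 0 f] fm by simp
  finally show ?thesis by simp
qed

text \<open>After folding the principal value about \<open>x\<close> the integrand is non-negative (since
  \<open>\<bar>x - z\<bar> \<le> x + z\<close>), so only the range \<open>z < 2 * x\<close> is kept, where moreover \<open>1 / z \<ge> 1 / (2 * x)\<close>.\<close>

lemma hilbert_transform_le_average:
  fixes f :: "real \<Rightarrow> real"
  assumes ev: "even_function f" and anti: "antimono_on {0<..} f" and cont: "continuous_on UNIV f"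
    and nonneg: "\<And>x. 0 \<le> f x"
    and x: "0 < x" and ht: "has_hilbert_transform f x h"
  shows "pi * h \<le> f x - integral {0..x} f / x"
proof -
  note le = even_antimono_abs_le[OF ev anti cont]
  let ?I = "\<lambda>\<epsilon> R. LINT y:{y. \<epsilon> < \<bar>y - x\<bar> \<and> \<bar>y - x\<bar> < R}|lborel. f y / (y - x)"
  \<comment> \<open>Fixed cutoffs first. The bound is uniform in \<open>R > 2 * x\<close>. Omitting
    \<open>z < \<epsilon>\<close> costs at most \<open>\<epsilon> * f 0\<close>, since
    \<open>f (x - z) - f x \<le> f 0\<close>, and this error vanishes in the limit.\<close>
  have bound: "1 / pi * ?I \<epsilon> R \<le> (f x - integral {0..x} f / x + \<epsilon> * f 0 / (2 * x)) / pi"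
    if e: "0 < \<epsilon>" "\<epsilon> < 2 * x" and R: "2 * x < R" for \<epsilon> R
  proof -
    let ?q = "\<lambda>z. (f (x - z) - f (x + z)) / z"
    let ?r = "\<lambda>z. f (x - z) - f x"
    have ci: "?q integrable_on {\<epsilon>..b}" "?r integrable_on {a..b}" for a b
      using e by (intro integrable_continuous_real continuous_intros
          continuous_on_compose2[OF cont]; auto)+
    have "integral {0..2*x} ?r - \<epsilon> * f 0 \<le> integral {\<epsilon>..2*x} ?r"
    proof -
      have "integral {0..\<epsilon>} ?r \<le> integral {0..\<epsilon>} (\<lambda>_. f 0)"
      proof (intro integral_le ci)
        show "?r z \<le> f 0" for z
          using nonneg[of x] le[of 0 "x - z"] by simp
      qed auto
      then have "integral {0..\<epsilon>} ?r \<le> \<epsilon> * f 0" using e by simp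
      moreover have "integral {0..\<epsilon>} ?r + integral {\<epsilon>..2*x} ?r = integral {0..2*x} ?r"
        using e by (intro Henstock_Kurzweil_Integration.integral_combine ci) auto
      ultimately show ?thesis by simp
    qed
    moreover have "integral {0..2*x} ?r = 2 * integral {0..x} f - 2 * x * f x"
      using x integral_even_about[OF ev cont, of x]
      by (subst Henstock_Kurzweil_Integration.integral_diff) (auto intro!: integrable_continuous_real continuous_intros
          continuous_on_compose2[OF cont])
    ultimately have "(2 * integral {0..x} f - 2 * x * f x - \<epsilon> * f 0) / (2 * x)
        \<le> integral {\<epsilon>..2*x} ?r / (2 * x)"
      using x by (intro divide_right_mono) auto
    also have "\<dots> = integral {\<epsilon>..2*x} (\<lambda>z. ?r z / (2 * x))"
      by simp
    \<comment> \<open>On this range \<open>\<bar>x - z\<bar> \<le> x\<close>, so the numerator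
      \<open>f (x - z) - f x\<close> is non-negative. Both shrinking the denominator from
      \<open>2 * x\<close> to \<open>z\<close> and replacing \<open>f x\<close> by the smaller
      \<open>f (x + z)\<close> then increase the quotient.\<close>
    also have "\<dots> \<le> integral {\<epsilon>..2*x} ?q"
    proof (intro integral_le ci)
      show "(\<lambda>z. ?r z / (2 * x)) integrable_on {\<epsilon>..2*x}"
        using ci(2) integrable_on_divide by blast
      fix z assume z: "z \<in> {\<epsilon>..2*x}"
      have "f x \<le> f (x - z)" "f (x + z) \<le> f x"
        using z e x by (auto intro!: le)
      then show "?r z / (2 * x) \<le> ?q z"
        using z e x by (intro frac_le) auto
    qed
    also have "\<dots> \<le> integral {\<epsilon>..R} ?q"
      using e R x by (intro integral_subset_le ci) (auto intro!: divide_nonneg_nonneg le)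
    also have "\<dots> = - ?I \<epsilon> R"
      using punctured_kernel_integral[OF cont, of \<epsilon> R x] e R by simp
    finally have "?I \<epsilon> R \<le> - ((2 * integral {0..x} f - 2 * x * f x - \<epsilon> * f 0) / (2 * x))"
      by simp
    also have "\<dots> = f x - integral {0..x} f / x + \<epsilon> * f 0 / (2 * x)"
      using x by (simp add: field_simps)
    finally show ?thesis by (simp add: divide_right_mono)
  qed
  let ?F = "at_right (0::real) \<times>\<^sub>F (at_top :: real filter)"
  \<comment> \<open>The vanishing term is written out so that the limit of the bound is literally
    the bound with 0 substituted for the inner radius.\<close>
  have "h \<le> (f x - integral {0..x} f / x + 0 * f 0 / (2 * x)) / pi"
  proof (rule tendsto_le)
    show "((\<lambda>(\<epsilon>, R). 1 / pi * ?I \<epsilon> R) \<longlongrightarrow> h) ?F"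
      using ht by (simp add: has_hilbert_transform_def)
    have "filterlim fst (at_right (0::real)) ?F"
      by (rule filterlim_fst)
    then have "(fst \<longlongrightarrow> (0::real)) ?F"
      by (simp add: filterlim_at)
    then show "((\<lambda>p. (f x - integral {0..x} f / x + fst p * f 0 / (2 * x)) / pi)
        \<longlongrightarrow> (f x - integral {0..x} f / x + 0 * f 0 / (2 * x)) / pi) ?F"
      using x by (intro tendsto_intros) auto
    show "\<forall>\<^sub>F p in ?F. (\<lambda>(\<epsilon>, R). 1 / pi * ?I \<epsilon> R) p
        \<le> (f x - integral {0..x} f / x + fst p * f 0 / (2 * x)) / pi"
      unfolding eventually_prod_filter
    proof (intro exI conjI allI impI)
      show "\<forall>\<^sub>F \<epsilon> in at_right 0. 0 < \<epsilon> \<and> \<epsilon> < 2 * x"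
        using x by (auto simp: eventually_at_right_field intro!: exI[of _ "2 * x"])
      show "\<forall>\<^sub>F R in at_top. 2 * x < R" by (rule eventually_gt_at_top)
    qed (use bound in auto)
    show "?F \<noteq> bot" by (simp add: prod_filter_eq_bot)
  qed
  then show ?thesis by (simp add: field_simps)
qed

section \<open>A quadratic lower bound for the dissipation\<close>

text \<open>Put \<open>H s = G (s\<^sup>2) / s\<^sup>2\<close> and \<open>P s = g (s\<^sup>2) - H s\<close>, so that \<open>H' = 2 * P / s\<close>. The function
  \<open>F = P\<^sup>2 / s + 5 / 4 * (2 * m * H - m\<^sup>2 * s)\<close> has derivative \<open>4 * P * g' - 5 * (P / s - m / 2)\<^sup>2\<close>;
  integrating \<open>F' \<le> 4 * P * g'\<close> with \<open>m = H 1\<close> replaces a Cauchy--Schwarz estimate of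
  \<open>\<integral> H'\<^sup>2\<close>.\<close>

lemma average_deficit_integral_ge:
  fixes g g' w :: "real \<Rightarrow> real"
  assumes der: "\<And>x. (g has_real_derivative g' x) (at x)"
    and contg': "continuous_on UNIV g'"
    and g0: "g 0 = 0" and g'_nonneg: "\<And>x. 0 \<le> x \<Longrightarrow> 0 \<le> g' x"
    and contw: "continuous_on {0..1} w" and w_nonneg: "\<And>x. 0 \<le> x \<Longrightarrow> x \<le> 1 \<Longrightarrow> 0 \<le> w x"
    and w_ge: "\<And>x. 0 < x \<Longrightarrow> x \<le> 1 \<Longrightarrow> (g x - integral {0..x} g / x) * g' x \<le> w x"
  shows "5 / 16 * (integral {0..1} g)\<^sup>2 \<le> integral {0..1} (\<lambda>s. w (s\<^sup>2))"
proof -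
  define m where "m = integral {0..1} g"
  define G where "G x = integral {0..x} g" for x
  define P where "P s = g (s\<^sup>2) - G (s\<^sup>2) / s\<^sup>2" for s
  define F where "F s = (P s)\<^sup>2 / s + 5 / 4 * (2 * m * (G (s\<^sup>2) / s\<^sup>2) - m\<^sup>2 * s)" for s
  have cg: "continuous_on A g" for A
    using der by (intro DERIV_continuous_on) (auto intro: has_field_derivative_at_within)
  have mono: "g x \<le> g y" if "0 \<le> x" "x \<le> y" for x y
  proof (rule DERIV_nonneg_imp_nondecreasing[OF that(2)])
    fix z assume "x \<le> z"
    then show "\<exists>d. (g has_real_derivative d) (at z) \<and> 0 \<le> d"
      using that der g'_nonneg[of z] by (intro exI[of _ "g' z"]) auto
  qed
  have g_nonneg: "0 \<le> g x" if "0 \<le> x" for x using mono[of 0 x] that g0 by simp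
  have derG: "(G has_real_derivative g x) (at x)" if "0 < x" for x
  proof -
    have "((\<lambda>u. integral {0..u} g) has_real_derivative g x) (at x within {0..x+1})"
      using that by (intro integral_has_real_derivative cg) auto
    then have "(G has_real_derivative g x) (at x within {0<..<x+1})"
      unfolding G_def by (rule DERIV_subset) auto
    then show ?thesis using that at_within_open[of x "{0<..<x+1}"] by auto
  qed
  have G_nonneg: "0 \<le> G x" if "0 \<le> x" for x
    unfolding G_def using that g_nonneg by (intro integral_nonneg integrable_continuous_real cg) auto
  have G_le: "G x \<le> x * g x" if "0 \<le> x" for x
  proof -
    have "G x \<le> integral {0..x} (\<lambda>_. g x)"
      unfolding G_def using that mono by (intro integral_le integrable_continuous_real cg) auto
    then show ?thesis using that by simp
  qed
  \<comment> \<open>\<open>F\<close> divides by \<open>s\<close>, so the integration has to start at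
    some \<open>e > 0\<close>. The bound \<open>M\<close> on \<open>g'\<close> gives
    \<open>g x \<le> M * x\<close>; hence \<open>P e\<close> and the average are at most
    \<open>M * e\<^sup>2\<close>, and the resulting upper bound for \<open>F e\<close> vanishes with
    \<open>e\<close>.\<close>
  have "bounded (g' ` {0..1})"
    by (intro compact_imp_bounded compact_continuous_image continuous_on_subset[OF contg']) auto
  then obtain M where M: "\<And>x. x \<in> {0..1} \<Longrightarrow> \<bar>g' x\<bar> \<le> M"
    unfolding bounded_iff by force
  have g_le: "g x \<le> M * x" if "0 \<le> x" "x \<le> 1" for x
  proof -
    have "(\<lambda>x. M * x - g x) 0 \<le> (\<lambda>x. M * x - g x) x"
    proof (intro DERIV_nonneg_imp_nondecreasing[of 0 x "\<lambda>x. M * x - g x"] that)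
      fix y assume "0 \<le> y" "y \<le> x"
      then show "\<exists>d. ((\<lambda>x. M * x - g x) has_real_derivative d) (at y) \<and> 0 \<le> d"
        using that M[of y] by (intro exI[of _ "M - g' y"]) (auto intro!: derivative_eq_intros der)
    qed
    then show ?thesis by (simp add: g0)
  qed
  have PH: "0 \<le> P s" "P s \<le> g (s\<^sup>2)" "G (s\<^sup>2) / s\<^sup>2 \<le> g (s\<^sup>2)" if "0 < s" for s
    using that G_nonneg[of "s\<^sup>2"] G_le[of "s\<^sup>2"]
    by (auto simp: P_def field_simps)
  have derF: "(F has_real_derivative 4 * (P s * g' (s\<^sup>2)) - 5 * (P s / s - m / 2)\<^sup>2) (at s)"
    if s: "0 < s" for s
  proof -
    have dg: "((\<lambda>s. g (s\<^sup>2)) has_real_derivative g' (s\<^sup>2) * (2 * s)) (at s)"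
      by (rule DERIV_chain2[OF der]) (auto intro!: derivative_eq_intros)
    have dG: "((\<lambda>s. G (s\<^sup>2)) has_real_derivative g (s\<^sup>2) * (2 * s)) (at s)"
      using s by (intro DERIV_chain2[OF derG]) (auto intro!: derivative_eq_intros)
    have dH: "((\<lambda>s. G (s\<^sup>2) / s\<^sup>2) has_real_derivative 2 * P s / s) (at s)"
    proof (rule DERIV_cong)
      show "((\<lambda>s. G (s\<^sup>2) / s\<^sup>2) has_real_derivative
          (g (s\<^sup>2) * (2 * s) * s\<^sup>2 - G (s\<^sup>2) * (2 * s)) / (s\<^sup>2 * s\<^sup>2)) (at s)"
        using s by (intro DERIV_divide dG) (auto intro!: derivative_eq_intros)
      show "(g (s\<^sup>2) * (2 * s) * s\<^sup>2 - G (s\<^sup>2) * (2 * s)) / (s\<^sup>2 * s\<^sup>2) = 2 * P s / s"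
        using s by (simp add: P_def field_simps power2_eq_square)
    qed
    have dP: "(P has_real_derivative g' (s\<^sup>2) * (2 * s) - 2 * P s / s) (at s)"
      unfolding P_def[abs_def] using DERIV_diff[OF dg dH] by (simp add: P_def)
    show ?thesis
      unfolding F_def[abs_def]
    proof (rule DERIV_cong)
      show "((\<lambda>s. (P s)\<^sup>2 / s + 5 / 4 * (2 * m * (G (s\<^sup>2) / s\<^sup>2) - m\<^sup>2 * s)) has_real_derivative
          ((2 * P s * (g' (s\<^sup>2) * (2 * s) - 2 * P s / s)) * s - (P s)\<^sup>2 * 1) / (s * s)
            + 5 / 4 * (2 * m * (2 * P s / s) - m\<^sup>2 * 1)) (at s)"
        using s by (intro DERIV_add DERIV_divide DERIV_cmult DERIV_diff dH DERIV_ident)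
          (auto intro!: derivative_eq_intros dP)
      \<comment> \<open>The term \<open>P\<^sup>2 / s\<close> contributes
        \<open>4 * P * g' - 5 * (P / s)\<^sup>2\<close>; the factor \<open>5 / 4\<close> in
        \<open>F\<close> is the one for which the remaining terms complete the square.\<close>
      show "((2 * P s * (g' (s\<^sup>2) * (2 * s) - 2 * P s / s)) * s - (P s)\<^sup>2 * 1) / (s * s)
            + 5 / 4 * (2 * m * (2 * P s / s) - m\<^sup>2 * 1)
          = 4 * (P s * g' (s\<^sup>2)) - 5 * (P s / s - m / 2)\<^sup>2"
        using s by (simp add: field_simps power2_eq_square)
    qed
  qed
  have bound: "F 1 - (M\<^sup>2 * e ^ 3 + 5 / 4 * (2 * m * (M * e\<^sup>2))) \<le> 4 * integral {0..1} (\<lambda>s. w (s\<^sup>2))"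
    if e: "0 < e" "e < 1" for e
  proof -
    have iw: "(\<lambda>s. w (s\<^sup>2)) integrable_on {a..1}" if "0 \<le> a" for a
      using that by (intro integrable_continuous_real continuous_on_compose2[OF contw] continuous_intros)
        (auto simp: power_le_one)
    have "F 1 - F e \<le> integral {e..1} (\<lambda>s. 4 * w (s\<^sup>2))"
    proof (rule has_integral_le)
      show "((\<lambda>s. 4 * (P s * g' (s\<^sup>2)) - 5 * (P s / s - m / 2)\<^sup>2) has_integral (F 1 - F e)) {e..1}"
        using e derF
        by (intro fundamental_theorem_of_calculus)
          (auto simp flip: has_real_derivative_iff_has_vector_derivative
            intro: has_field_derivative_at_within)
      show "((\<lambda>s. 4 * w (s\<^sup>2)) has_integral integral {e..1} (\<lambda>s. 4 * w (s\<^sup>2))) {e..1}"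
        using e iw[of e] by (intro integrable_integral integrable_on_mult_right) auto
      fix s assume s: "s \<in> {e..1}"
      have "P s * g' (s\<^sup>2) \<le> w (s\<^sup>2)"
        using s e w_ge[of "s\<^sup>2"] by (auto simp: P_def G_def power_le_one)
      moreover have "0 \<le> (P s / s - m / 2)\<^sup>2" by simp
      ultimately show "4 * (P s * g' (s\<^sup>2)) - 5 * (P s / s - m / 2)\<^sup>2 \<le> 4 * w (s\<^sup>2)"
        by linarith
    qed
    also have "\<dots> = 4 * integral {e..1} (\<lambda>s. w (s\<^sup>2))" by simp
    also have "\<dots> \<le> 4 * integral {0..1} (\<lambda>s. w (s\<^sup>2))"
      using e by (intro mult_left_mono integral_subset_le iw) (auto intro!: w_nonneg simp: power_le_one)
    finally have "F 1 - F e \<le> 4 * integral {0..1} (\<lambda>s. w (s\<^sup>2))" .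
    moreover have "F e \<le> M\<^sup>2 * e ^ 3 + 5 / 4 * (2 * m * (M * e\<^sup>2))"
    proof -
      have ge: "g (e\<^sup>2) \<le> M * e\<^sup>2" using e by (intro g_le) (auto simp: power_le_one)
      have "(P e)\<^sup>2 \<le> (M * e\<^sup>2)\<^sup>2" using PH[of e] e ge by (intro power_mono) auto
      then have "(P e)\<^sup>2 / e \<le> (M * e\<^sup>2)\<^sup>2 / e" using e by (intro divide_right_mono) auto
      also have "\<dots> = M\<^sup>2 * e ^ 3" using e by (simp add: field_simps power2_eq_square power3_eq_cube)
      finally have "(P e)\<^sup>2 / e \<le> M\<^sup>2 * e ^ 3" .
      moreover have "0 \<le> m" using G_nonneg[of 1] by (simp add: m_def G_def)
      then have "m * (G (e\<^sup>2) / e\<^sup>2) \<le> m * (M * e\<^sup>2)" using PH(3)[of e] e ge by (intro mult_left_mono) auto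
      moreover have "0 \<le> m\<^sup>2 * e" using e by simp
      moreover have "A + 5 / 4 * (2 * m * q - n) \<le> B + 5 / 4 * (2 * m * r)"
        if "A \<le> B" "m * q \<le> m * r" "0 \<le> n" for A B q r n
        using that by (simp add: field_simps)
      ultimately show ?thesis unfolding F_def by blast
    qed
    ultimately show ?thesis by linarith
  qed
  have "F 1 - (M\<^sup>2 * 0 ^ 3 + 5 / 4 * (2 * m * (M * 0\<^sup>2))) \<le> 4 * integral {0..1} (\<lambda>s. w (s\<^sup>2))"
  proof (rule tendsto_upperbound)
    show "((\<lambda>e. F 1 - (M\<^sup>2 * e ^ 3 + 5 / 4 * (2 * m * (M * e\<^sup>2))))
        \<longlongrightarrow> F 1 - (M\<^sup>2 * 0 ^ 3 + 5 / 4 * (2 * m * (M * 0\<^sup>2)))) (at_right 0)"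
      by (intro tendsto_intros)
    show "\<forall>\<^sub>F e in at_right 0. F 1 - (M\<^sup>2 * e ^ 3 + 5 / 4 * (2 * m * (M * e\<^sup>2)))
        \<le> 4 * integral {0..1} (\<lambda>s. w (s\<^sup>2))"
      using bound by (auto simp: eventually_at_right_field intro!: exI[of _ 1])
  qed simp
  \<comment> \<open>At \<open>s = 1\<close> the average equals \<open>m\<close>, so the bracket in
    \<open>F\<close> becomes \<open>2 * m\<^sup>2 - m\<^sup>2\<close> and the square of
    \<open>P 1\<close> is dropped. Dividing by the factor 4 in front of the integral yields
    \<open>5 / 16\<close>.\<close>
  moreover have "5 / 4 * m\<^sup>2 \<le> F 1"
    unfolding F_def by (simp add: G_def m_def power2_eq_square)
  ultimately show ?thesis by (simp add: m_def)
qed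

section \<open>Growth under a quadratic differential inequality\<close>

text \<open>Since \<open>J\<close> never falls below \<open>J 0\<close>, its derivative stays above
  the positive constant \<open>c * (J 0)\<^sup>2\<close>. As all times are available, this linear
  growth already passes every bound, without solving the Riccati inequality.\<close>

lemma unbounded_of_derivative_ge_square:
  fixes J J' :: "real \<Rightarrow> real"
  assumes der: "\<And>t. 0 \<le> t \<Longrightarrow> (J has_real_derivative J' t) (at t within {0..})"
    and J'_ge: "\<And>t. 0 \<le> t \<Longrightarrow> c * (J t)\<^sup>2 \<le> J' t"
    and c: "0 < c" and J0: "0 < J 0"
  shows "\<exists>t\<ge>0. B < J t"
proof -
  have mvt: "\<exists>z\<in>{0..t}. J t - J 0 = J' z * t" if "0 \<le> t" for t
  proof -
    have "\<exists>z\<in>{0..t}. J t - J 0 = (*) (J' z) (t - 0)"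
    proof (rule mvt_very_simple[OF that])
      fix z :: real assume "0 \<le> z"
      then have "(J has_real_derivative J' z) (at z within {0..t})"
        by (rule DERIV_subset[OF der]) auto
      then show "(J has_derivative (*) (J' z)) (at z within {0..t})"
        by (simp add: has_field_derivative_def)
    qed
    then show ?thesis by simp
  qed
  have ge: "J 0 \<le> J t" if t: "0 \<le> t" for t
  proof -
    obtain z where z: "z \<in> {0..t}" "J t - J 0 = J' z * t" using mvt[OF t] by blast
    have "0 \<le> c * (J z)\<^sup>2" using c by simp
    then have "0 \<le> J' z" using J'_ge[of z] z by auto
    then show ?thesis using z t by (smt (verit) mult_nonneg_nonneg)
  qed
  \<comment> \<open>At this time the guaranteed growth equals \<open>\<bar>B\<bar>\<close>; the
    positive starting value \<open>J 0\<close> makes the final inequality strict.\<close>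
  define t where "t = \<bar>B\<bar> / (c * (J 0)\<^sup>2)"
  have t: "0 \<le> t" using c by (simp add: t_def)
  obtain z where z: "z \<in> {0..t}" "J t - J 0 = J' z * t" using mvt[OF t] by blast
  have "c * (J 0)\<^sup>2 \<le> c * (J z)\<^sup>2" using c J0 ge[of z] z by (intro mult_left_mono power_mono) auto
  then have "c * (J 0)\<^sup>2 * t \<le> J' z * t" using J'_ge[of z] z t by (intro mult_right_mono) auto
  moreover have "c * (J 0)\<^sup>2 * t = \<bar>B\<bar>" using c J0 by (simp add: t_def)
  ultimately have "B < J t" using z J0 by linarith
  then show ?thesis using t by blast
qed

section \<open>The deficit functional along a global solution\<close>

theorem theorem6p4:
  fixes \<theta>\<^sub>0 :: "real \<Rightarrow> real"
  assumes "smooth \<theta>\<^sub>0"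
    and "\<forall>x. 0 \<le> \<theta>\<^sub>0 x"
    and "decays_at_infinity \<theta>\<^sub>0"
    and "even_function \<theta>\<^sub>0"
    and "antimono_on {0<..} \<theta>\<^sub>0"
    and "\<theta>\<^sub>0 (1 / 2) < \<theta>\<^sub>0 0"
  shows "\<not> (\<exists>\<theta> :: real \<Rightarrow> real \<Rightarrow> real.
            global_C1_solution \<theta> \<and>
            (\<forall>x. \<theta> 0 x = \<theta>\<^sub>0 x) \<and>
            (\<forall>t>0. (\<forall>x. 0 \<le> \<theta> t x) \<and> decays_at_infinity (\<theta> t) \<and>
                   even_function (\<theta> t) \<and> antimono_on {0<..} (\<theta> t)))"
proof
  assume "\<exists>\<theta> :: real \<Rightarrow> real \<Rightarrow> real.
            global_C1_solution \<theta> \<and>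
            (\<forall>x. \<theta> 0 x = \<theta>\<^sub>0 x) \<and>
            (\<forall>t>0. (\<forall>x. 0 \<le> \<theta> t x) \<and> decays_at_infinity (\<theta> t) \<and>
                   even_function (\<theta> t) \<and> antimono_on {0<..} (\<theta> t))"
  then obtain \<theta> :: "real \<Rightarrow> real \<Rightarrow> real" where sol: "global_C1_solution \<theta>"
    and init: "\<And>x. \<theta> 0 x = \<theta>\<^sub>0 x"
    and later: "\<And>t. t > 0 \<Longrightarrow> (\<forall>x. 0 \<le> \<theta> t x) \<and> even_function (\<theta> t) \<and> antimono_on {0<..} (\<theta> t)"
    by blast
  have "\<theta> 0 = \<theta>\<^sub>0" using init by auto
  \<comment> \<open>The inherited properties are assumed for positive times only; at time 0 they are
    those of the data.\<close>
  then have shape: "(\<forall>x. 0 \<le> \<theta> t x) \<and> even_function (\<theta> t) \<and> antimono_on {0<..} (\<theta> t)" if "0 \<le> t" for t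
    using that later[of t] assms by (cases "t = 0") auto
  from sol obtain \<theta>\<^sub>t \<theta>\<^sub>x u where
    dt: "\<And>t x. 0 \<le> t \<Longrightarrow> ((\<lambda>s. \<theta> s x) has_real_derivative \<theta>\<^sub>t t x) (at t within {0..})"
    and dx: "\<And>t x. 0 \<le> t \<Longrightarrow> (\<theta> t has_real_derivative \<theta>\<^sub>x t x) (at x)"
    and ct: "continuous_on ({0..} \<times> UNIV) (\<lambda>(t, x). \<theta>\<^sub>t t x)"
    and cx: "continuous_on ({0..} \<times> UNIV) (\<lambda>(t, x). \<theta>\<^sub>x t x)"
    and ht: "\<And>t x. 0 \<le> t \<Longrightarrow> has_hilbert_transform (\<theta> t) x (u t x)"
    and eq: "\<And>t x. 0 \<le> t \<Longrightarrow> \<theta>\<^sub>t t x + u t x * \<theta>\<^sub>x t x = 0"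
    unfolding global_C1_solution_def has_C1_partials_def by blast
  have cont: "continuous_on A (\<theta> t)" if "0 \<le> t" for t A
    using dx[OF that] by (intro DERIV_continuous_on) (auto intro: has_field_derivative_at_within)
  have cont_x: "continuous_on A (\<theta>\<^sub>x t)" if "0 \<le> t" for t A
    by (rule continuous_on_compose2[OF cx, of A "\<lambda>x. (t, x)", simplified])
      (use that in \<open>auto intro!: continuous_intros\<close>)
  have cont_t: "continuous_on A (\<theta>\<^sub>t t)" if "0 \<le> t" for t A
    by (rule continuous_on_compose2[OF ct, of A "\<lambda>x. (t, x)", simplified])
      (use that in \<open>auto intro!: continuous_intros\<close>)
  have le: "\<theta> t b \<le> \<theta> t a" if "0 \<le> t" "\<bar>a\<bar> \<le> \<bar>b\<bar>" for t a b
    using even_antimono_abs_le[of "\<theta> t"] shape[of t] cont[of t] that by blast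
  have x_nonpos: "\<theta>\<^sub>x t x \<le> 0" if "0 \<le> t" "0 \<le> x" for t x
    using even_antimono_deriv_nonpos[of "\<theta> t", OF _ _ _ dx] shape[of t] cont[of t] that by blast
  have t_zero: "\<theta>\<^sub>t t 0 = 0" if "0 \<le> t" for t
    using even_deriv_zero[of "\<theta> t", OF _ dx] shape[of t] that eq[of t 0] by auto
  \<comment> \<open>Conservation of the central value has one purpose: together with non-negativity
    it will bound \<open>J\<close> by \<open>\<theta>\<^sub>0 0\<close> for all times.\<close>
  have center: "\<theta> t 0 = \<theta>\<^sub>0 0" if "0 \<le> t" for t
  proof -
    have "((\<lambda>s. \<theta> s 0) has_real_derivative 0) (at s within {0..})" if "s \<in> {0..}" for s
      using dt[of s 0] t_zero[of s] that by simp
    then obtain c where "\<forall>s\<in>{0..}. \<theta> s 0 = c"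
      using has_field_derivative_zero_constant[of "{0..}" "\<lambda>s. \<theta> s 0"] by auto
    then show ?thesis using that init[of 0] by auto
  qed
  define J where "J t = integral {0..1} (\<lambda>s. \<theta> t 0 - \<theta> t (s\<^sup>2))" for t
  \<comment> \<open>The term \<open>\<theta>\<^sub>t t 0\<close> is zero, but keeping it makes the
    integrand the literal time derivative of the one in \<open>J\<close>.\<close>
  define J' where "J' t = integral {0..1} (\<lambda>s. \<theta>\<^sub>t t 0 - \<theta>\<^sub>t t (s\<^sup>2))" for t
  have Ji: "(\<lambda>s. \<theta> t 0 - \<theta> t (s\<^sup>2)) integrable_on {0..1}" if "0 \<le> t" for t
    by (intro integrable_continuous_real continuous_intros continuous_on_compose2[OF cont[OF that]]) auto
  have derJ: "(J has_real_derivative J' t) (at t within {0..})" if t: "0 \<le> t" for t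
    \<comment> \<open>The rule expects \<open>cbox\<close>. Its parameter set \<open>{0..}\<close>
      is convex, so the one-sided derivative at time 0 is included.\<close>
    unfolding J_def J'_def box_real[symmetric]
  proof (rule leibniz_rule_field_derivative)
    have "continuous_on ({0..} \<times> cbox 0 1) (\<lambda>p. (\<lambda>(t, x). \<theta>\<^sub>t t x) (fst p, 0) - (\<lambda>(t, x). \<theta>\<^sub>t t x) (fst p, (snd p)\<^sup>2))"
      by (intro continuous_intros continuous_on_compose2[OF ct]) auto
    then show "continuous_on ({0..} \<times> cbox (0::real) 1) (\<lambda>(t, s). \<theta>\<^sub>t t 0 - \<theta>\<^sub>t t (s\<^sup>2))"
      by (simp add: case_prod_unfold)
  qed (use t Ji in \<open>auto intro!: derivative_intros dt\<close>)
  have J_ge: "5 / (16 * pi) * (J t)\<^sup>2 \<le> J' t" if t: "0 \<le> t" for t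
  proof -
    let ?g = "\<lambda>x. \<theta> t 0 - \<theta> t x"
    have ig: "integral {0..x} ?g = x * \<theta> t 0 - integral {0..x} (\<theta> t)" if "0 \<le> x" for x
      using that by (subst Henstock_Kurzweil_Integration.integral_diff) (auto intro!: integrable_continuous_real cont t)
    \<comment> \<open>The velocity bound is multiplied by the non-negative
      \<open>- \<theta>\<^sub>x\<close>, and the equation turns the product into a time derivative.
      Thus \<open>w = - pi * \<theta>\<^sub>t\<close> serves in the averaging lemma, its continuity
      being that of \<open>\<theta>\<^sub>t\<close>.\<close>
    have w_ge: "(?g x - integral {0..x} ?g / x) * - \<theta>\<^sub>x t x \<le> - pi * \<theta>\<^sub>t t x" if x: "0 < x" for x
    proof -
      have "pi * u t x \<le> \<theta> t x - integral {0..x} (\<theta> t) / x"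
        using shape[OF t] by (intro hilbert_transform_le_average cont ht t x) auto
      then have "?g x - integral {0..x} ?g / x \<le> - pi * u t x"
        using x by (simp add: ig diff_divide_distrib)
      then have "(?g x - integral {0..x} ?g / x) * - \<theta>\<^sub>x t x \<le> (- pi * u t x) * - \<theta>\<^sub>x t x"
        using x x_nonpos[OF t, of x] by (intro mult_right_mono) auto
      also have "\<dots> = pi * (u t x * \<theta>\<^sub>x t x)" by simp
      also have "u t x * \<theta>\<^sub>x t x = - \<theta>\<^sub>t t x" using eq[OF t, of x] by linarith
      finally show ?thesis by simp
    qed
    have w_nonneg: "0 \<le> - pi * \<theta>\<^sub>t t x" if x: "0 \<le> x" for x
    proof (cases "x = 0")
      case False
      have "integral {0..x} ?g \<le> integral {0..x} (\<lambda>_. ?g x)"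
        using t x by (intro integral_le integrable_continuous_real continuous_intros cont)
          (auto intro!: le)
      then have "integral {0..x} ?g / x \<le> ?g x"
        using x False by (simp add: field_simps)
      then have "0 \<le> (?g x - integral {0..x} ?g / x) * - \<theta>\<^sub>x t x"
        using x_nonpos[OF t x] by (intro mult_nonneg_nonneg) auto
      then show ?thesis using w_ge[of x] x False by linarith
    qed (simp add: t_zero t)
    have "5 / 16 * (integral {0..1} ?g)\<^sup>2 \<le> integral {0..1} (\<lambda>s. - pi * \<theta>\<^sub>t t (s\<^sup>2))"
    proof (rule average_deficit_integral_ge[where g' = "\<lambda>x. - \<theta>\<^sub>x t x"])
      show "(?g has_real_derivative - \<theta>\<^sub>x t x) (at x)" for x
        by (auto intro!: derivative_eq_intros dx t)
    qed (use w_ge w_nonneg x_nonpos t in \<open>auto intro!: continuous_intros cont_x cont_t\<close>)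
    also have "\<dots> = pi * J' t"
      by (simp add: J'_def t_zero t)
    finally have 1: "5 / 16 * (integral {0..1} ?g)\<^sup>2 \<le> pi * J' t" .
    \<comment> \<open>On \<open>{0..1}\<close> one has \<open>s\<^sup>2 \<le> s\<close>, and the
      deficit grows with the distance from the origin. The plain integral of the deficit therefore
      dominates \<open>J\<close>, which closes the inequality in terms of \<open>J\<close>
      alone.\<close>
    have "J t \<le> integral {0..1} ?g"
      unfolding J_def
      using t by (intro integral_le Ji integrable_continuous_real continuous_intros cont)
        (auto intro!: le simp: power2_eq_square mult_left_le_one_le)
    moreover have "0 \<le> J t"
      unfolding J_def using t by (intro integral_nonneg Ji) (auto intro!: le)
    ultimately have "(J t)\<^sup>2 \<le> (integral {0..1} ?g)\<^sup>2" by (intro power_mono)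
    with 1 have "5 / 16 * (J t)\<^sup>2 \<le> pi * J' t" by linarith
    then show ?thesis by (simp add: field_simps)
  qed
  have J0: "0 < J 0"
  proof -
    \<comment> \<open>The window \<open>{3/4..1}\<close> works because
      \<open>(3/4)\<^sup>2 = 9/16\<close> exceeds \<open>1/2\<close>: there the integrand is at
      least \<open>d\<close>, so that \<open>d / 4 \<le> J 0\<close>.\<close>
    define d where "d = \<theta>\<^sub>0 0 - \<theta>\<^sub>0 (1 / 2)"
    have "integral {3/4..1} (\<lambda>_::real. d) \<le> integral {3/4..1} (\<lambda>s. \<theta> 0 0 - \<theta> 0 (s\<^sup>2))"
    proof (rule integral_le)
      fix s :: real assume s: "s \<in> {3/4..1}"
      have "(3/4)\<^sup>2 \<le> s\<^sup>2" using s by (intro power_mono) auto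
      then have "1 / 2 \<le> s\<^sup>2" by (simp add: power2_eq_square)
      then have "\<theta> 0 (s\<^sup>2) \<le> \<theta> 0 (1 / 2)" by (intro le) auto
      then show "d \<le> \<theta> 0 0 - \<theta> 0 (s\<^sup>2)" by (simp add: d_def init)
    qed (auto intro: integrable_subinterval_real[OF Ji])
    also have "\<dots> \<le> J 0"
      unfolding J_def
      by (intro integral_subset_le) (auto intro: integrable_subinterval_real[OF Ji] intro!: le)
    finally show ?thesis using assms(6) by (simp add: d_def)
  qed
  obtain t where t: "0 \<le> t" "\<theta>\<^sub>0 0 < J t"
    using unbounded_of_derivative_ge_square[OF derJ J_ge _ J0] by auto
  \<comment> \<open>The contradiction: a conserved central value and \<open>\<theta> \<ge> 0\<close>
    keep the integrand below \<open>\<theta>\<^sub>0 0\<close>.\<close>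
  have "J t \<le> integral {0..1} (\<lambda>_::real. \<theta>\<^sub>0 0)"
    unfolding J_def using t shape[of t] by (intro integral_le Ji) (auto simp: center)
  then show False using t by simp
qed

end
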